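(* For all integers $n \ge 1$ and all real $\theta$ with $\pi/3 \le \theta \le \pi$, $$\Delta_{\mathbb{R}^n} \leq \sin^n(\theta/2)\, A(n,\theta).$$
   Context: $\Delta_{\mathbb{R}^n}$ is the maximal density of a packing of $\mathbb{R}^n$ by congruent balls (non-overlapping, i.e. with pairwise disjoint interiors): the supremum over all such packings of the upper density, where the upper density of a packing is the limit superior, as $R\to\infty$, of the fraction of the ball of radius $R$ centered at a fixed point that is covered by the balls of the packing. $A(n,\theta)$ is the greatest size of a spherical code in $\mathbb{R}^n$ with minimum angle $\theta$, i.e. of a set of points on the unit sphere $S^{n-1}\subset\mathbb{R}^n$ such that $\langle x,y\rangle \le \cos\theta$ for all pairs of distinct points $x,y$ in the set. *)

theory Defs
  imports "HOL-Analysis.Analysis"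
begin

definition ball_packing :: "'a::euclidean_space set set \<Rightarrow> bool" where
  "ball_packing P \<longleftrightarrow>
     (\<exists>r>0. \<forall>B\<in>P. \<exists>c. B = cball c r) \<and>
     pairwise (\<lambda>B B'. disjnt (interior B) (interior B')) P"

text \<open>The fixed point at which the exhausting balls are centered is taken to be the origin.\<close>

definition upper_density :: "'a::euclidean_space set set \<Rightarrow> ereal" where
  "upper_density P =
     Limsup at_top (\<lambda>R::real.
       ereal (measure lebesgue (\<Union>P \<inter> cball 0 R) / measure lebesgue (cball (0::'a) R)))"

definition packing_density :: "'a::euclidean_space itself \<Rightarrow> ereal" where
  "packing_density _ = (SUP P\<in>{P :: 'a set set. ball_packing P}. upper_density P)"

definition spherical_code :: "real \<Rightarrow> 'a::euclidean_space set \<Rightarrow> bool" where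
  "spherical_code \<theta> C \<longleftrightarrow>
     C \<subseteq> sphere 0 1 \<and> (\<forall>x\<in>C. \<forall>y\<in>C. x \<noteq> y \<longrightarrow> x \<bullet> y \<le> cos \<theta>)"

definition max_code_size :: "'a::euclidean_space itself \<Rightarrow> real \<Rightarrow> nat" where
  "max_code_size _ \<theta> = (GREATEST k. \<exists>C :: 'a set. spherical_code \<theta> C \<and> finite C \<and> card C = k)"

text \<open>For \<open>0 < \<theta> \<le> \<pi>\<close> all spherical codes are finite, with a common bound on their sizes, so that
  the greatest size exists and the restriction to finite codes excludes nothing.\<close>

lemma spherical_code_bounded:
  assumes "0 < \<theta>" "\<theta> \<le> pi"
  shows "\<exists>N. \<forall>C :: 'a::euclidean_space set. spherical_code \<theta> C \<longrightarrow> finite C \<and> card C \<le> N"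
proof -
  have "cos \<theta> < cos 0"
    using assms by (intro cos_monotone_0_pi) auto
  define d where "d = sqrt (2 - 2 * cos \<theta>)"
  have d: "d > 0" "d\<^sup>2 = 2 - 2 * cos \<theta>"
    using \<open>cos \<theta> < cos 0\<close> by (auto simp: d_def)
  have "sphere (0::'a) 1 \<subseteq> (\<Union>x\<in>sphere 0 1. ball x (d / 2))"
    using d(1) by auto
  then obtain K where K: "finite K" "sphere (0::'a) 1 \<subseteq> (\<Union>x\<in>K. ball x (d / 2))"
    using compactE_image[OF compact_sphere, of "sphere (0::'a) 1" "\<lambda>x. ball x (d / 2)"]
      open_ball by metis
  have "finite C \<and> card C \<le> card K" if C: "spherical_code \<theta> C" for C :: "'a set"
  proof -
    have "\<forall>x\<in>C. \<exists>z\<in>K. dist z x < d / 2"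
      using C K(2) unfolding spherical_code_def subset_iff UN_iff mem_ball by meson
    then obtain f where f: "\<And>x. x \<in> C \<Longrightarrow> f x \<in> K \<and> dist (f x) x < d / 2"
      by metis
    have "inj_on f C"
    proof (rule inj_onI, rule ccontr)
      fix x y assume xy: "x \<in> C" "y \<in> C" "f x = f y" "x \<noteq> y"
      have "norm x = 1" "norm y = 1" "x \<bullet> y \<le> cos \<theta>"
        using C xy by (auto simp: spherical_code_def)
      then have "d\<^sup>2 \<le> (norm (x - y))\<^sup>2"
        using d(2) dot_norm_neg[of x y] by simp
      then have "d \<le> dist x y"
        unfolding dist_norm by (rule power2_le_imp_le) simp
      moreover have "dist x y < d"
        using f[OF xy(1)] f[OF xy(2)] xy(3) dist_triangle_half_r[of "f x" x d y] by simp
      ultimately show False by simp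
    qed
    then show ?thesis
      using f K(1) card_inj_on_le[of f C K] inj_on_finite[of f C K] by (simp add: image_subset_iff)
  qed
  then show ?thesis by blast
qed

end

theory Submission imports Defs
begin

text \<open>
  Let the balls of the packing have radius \<open>r\<close> and enlarge them, as open balls, to the radius
  \<open>R = r / sin (\<theta> / 2)\<close>. The condition \<open>\<theta> \<ge> pi / 3\<close> means \<open>R \<le> 2 * r\<close>, and the centers are at
  distance at least \<open>2 * r\<close> from each other; by the law of cosines, the directions from a point \<open>p\<close>
  to the centers of the enlarged balls containing it therefore form a spherical code of minimum
  angle \<open>\<theta>\<close>. So the enlarged balls cover each point at most \<open>A(n,\<theta>)\<close> times, and comparing volumes
  gives the bound on the density.
\<close>

section \<open>Sizes of spherical codes\<close>

text \<open>\<open>GREATEST\<close> is meaningful only for a bounded predicate;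
  \<open>spherical_code_bounded\<close> supplies the bound, and also the finiteness of
  \<open>C\<close>.\<close>

lemma card_le_max_code_size:
  fixes C :: "'a::euclidean_space set"
  assumes "0 < \<theta>" "\<theta> \<le> pi" "spherical_code \<theta> C"
  shows "card C \<le> max_code_size TYPE('a) \<theta>"
proof -
  obtain N where N: "\<forall>C :: 'a set. spherical_code \<theta> C \<longrightarrow> finite C \<and> card C \<le> N"
    using spherical_code_bounded[OF assms(1,2)] by blast
  show ?thesis
    unfolding max_code_size_def using N assms(3) by (intro Greatest_le_nat[where b = N]) blast+
qed

text \<open>A single unit vector is a code. This settles the degenerate case where a covered point
  is itself a center and so has no direction to it.\<close>

lemma max_code_size_pos:
  assumes "0 < \<theta>" "\<theta> \<le> pi"
  shows "1 \<le> max_code_size TYPE('a::euclidean_space) \<theta>"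
proof -
  obtain b :: 'a where "b \<in> Basis"
    using nonempty_Basis by blast
  then have "spherical_code \<theta> {b}"
    by (simp add: spherical_code_def)
  then show ?thesis
    using card_le_max_code_size[OF assms] by fastforce
qed

section \<open>Directions from a point to separated centers\<close>

text \<open>In the application \<open>u\<close> and \<open>v\<close> lead from a point to two
  centers, \<open>s\<close> is the sine of half of \<open>\<theta>\<close>, and the last factor is
  \<open>cos \<theta>\<close>. By the law of cosines the claim reduces to the inequality
  \<open>key\<close> between the norms.\<close>

lemma separated_inner_le:
  fixes u v :: "'a::real_inner"
  assumes s: "1 / 2 \<le> s" and u: "norm u \<le> R" and v: "norm v \<le> R"
    and sep: "2 * (s * R) \<le> dist u v"
  shows "u \<bullet> v \<le> norm u * norm v * (1 - 2 * s\<^sup>2)"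
proof -
  \<comment> \<open>Chain: \<open>(b - a)\<^sup>2 \<le> b * (b - a) \<le> R\<^sup>2 - a * b\<close>,
    and the last term is nonnegative, so the factor \<open>4 * s\<^sup>2 \<ge> 1\<close> can only
    enlarge it.\<close>
  have key: "(b - a)\<^sup>2 \<le> 4 * s\<^sup>2 * (R\<^sup>2 - a * b)" if "0 \<le> a" "a \<le> b" "b \<le> R" for a b
  proof -
    have "(1 / 2)\<^sup>2 \<le> s\<^sup>2"
      using s by (intro power_mono) auto
    then have s2: "1 \<le> 4 * s\<^sup>2"
      by (simp add: power2_eq_square)
    have "b * b \<le> R * R"
      using that by (intro mult_mono) auto
    then have R: "b * (b - a) \<le> R\<^sup>2 - a * b"
      by (simp add: power2_eq_square algebra_simps)
    have nonneg: "0 \<le> R\<^sup>2 - a * b"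
      using that by (intro order_trans[OF _ R]) simp
    have "(b - a)\<^sup>2 \<le> b * (b - a)"
      using that by (simp add: power2_eq_square mult_right_mono)
    also have "\<dots> \<le> 1 * (R\<^sup>2 - a * b)"
      using R by simp
    also have "\<dots> \<le> 4 * s\<^sup>2 * (R\<^sup>2 - a * b)"
      using s2 nonneg by (intro mult_right_mono)
    finally show ?thesis .
  qed
  have "0 \<le> R"
    using u norm_ge_zero order_trans by blast
  then have "(2 * (s * R))\<^sup>2 \<le> (norm (u - v))\<^sup>2"
    using sep s by (intro power_mono) (auto simp: dist_norm)
  then have "2 * (u \<bullet> v) \<le> (norm u)\<^sup>2 + (norm v)\<^sup>2 - 4 * s\<^sup>2 * R\<^sup>2"
    using dot_norm_neg[of u v] by (simp add: power_mult_distrib)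
  moreover have "(norm v - norm u)\<^sup>2 \<le> 4 * s\<^sup>2 * (R\<^sup>2 - norm u * norm v)"
    using key[of "norm u" "norm v"] key[of "norm v" "norm u"] u v
    by (cases "norm u \<le> norm v") (auto simp: power2_commute mult.commute)
  ultimately show ?thesis
    by (simp add: power2_diff algebra_simps)
qed

lemma card_separated_le_max_code_size:
  fixes Y :: "'a::euclidean_space set"
  assumes \<theta>: "pi / 3 \<le> \<theta>" "\<theta> \<le> pi" and Y: "Y \<subseteq> ball p (r / sin (\<theta> / 2))"
    and sep: "\<And>x y. x \<in> Y \<Longrightarrow> y \<in> Y \<Longrightarrow> x \<noteq> y \<Longrightarrow> 2 * r \<le> dist x y"
  shows "card Y \<le> max_code_size TYPE('a) \<theta>"
proof -
  define s where "s = sin (\<theta> / 2)"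
  define R where "R = r / s"
  have \<theta>0: "0 < \<theta>"
    using \<theta> pi_gt_zero by linarith
  have "sin (pi / 6) \<le> s"
    unfolding s_def using \<theta> pi_gt_zero by (intro sin_monotone_2pi_le) auto
  then have s: "1 / 2 \<le> s"
    by (simp add: sin_30)
  have cos: "cos \<theta> = 1 - 2 * s\<^sup>2"
    using cos_double_sin[of "\<theta> / 2"] by (simp add: s_def)
  have r: "r = s * R"
    using s by (simp add: R_def)
  have Y_R: "dist p x < R" if "x \<in> Y" for x
    using Y that by (auto simp: R_def s_def)
  show ?thesis
  \<comment> \<open>If \<open>p\<close> is a center, any other point of \<open>Y\<close> would be at
    distance at least \<open>2 * r \<ge> R\<close> from it, hence outside the open ball; so
    \<open>Y\<close> is just \<open>{p}\<close>. Otherwise all directions from \<open>p\<close> are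
    defined.\<close>
  proof (cases "p \<in> Y")
    case True
    have "x = p" if "x \<in> Y" for x
    proof (rule ccontr)
      assume "x \<noteq> p"
      then have "2 * (s * R) < R"
        using sep[OF True that] Y_R[OF that] r by auto
      moreover have "R * 1 \<le> R * (2 * s)"
        using s Y_R[OF True] by (intro mult_left_mono) auto
      ultimately show False
        by (simp add: algebra_simps)
    qed
    then have "card Y \<le> card {p}"
      by (intro card_mono) auto
    then show ?thesis
      using max_code_size_pos[OF \<theta>0 \<theta>(2), where 'a = 'a] by simp
  next
    case False
    define f where "f x = sgn (x - p)" for x
    have f: "f x \<bullet> f y \<le> cos \<theta>" if "x \<in> Y" "y \<in> Y" "x \<noteq> y" for x y
    proof -
      have "(x - p) \<bullet> (y - p) \<le> norm (x - p) * norm (y - p) * cos \<theta>"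
        unfolding cos
      proof (rule separated_inner_le[OF s])
        show "norm (x - p) \<le> R" "norm (y - p) \<le> R"
          using Y_R[of x] Y_R[of y] that by (auto simp: dist_norm norm_minus_commute)
        show "2 * (s * R) \<le> dist (x - p) (y - p)"
          using sep[of x y] that r by (simp add: dist_norm)
      qed
      moreover have "0 < norm (x - p)" "0 < norm (y - p)"
        using False that by auto
      ultimately show ?thesis
        by (simp add: f_def sgn_div_norm divide_simps mult_ac)
    qed
    have norm_f: "norm (f x) = 1" if "x \<in> Y" for x
      using that False by (auto simp: f_def norm_sgn)
    have "cos \<theta> < 1"
      using cos_monotone_0_pi[of 0 \<theta>] \<theta>0 \<theta>(2) by simp
    \<comment> \<open>Two points with the same direction would give the inner product 1, which
      exceeds \<open>cos \<theta>\<close>. Hence the code has as many points as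
      \<open>Y\<close>.\<close>
    then have "inj_on f Y"
      using f norm_f by (intro inj_onI) (metis dot_square_norm linorder_not_less power_one)
    moreover have "spherical_code \<theta> (f ` Y)"
      using f norm_f by (auto simp: spherical_code_def)
    ultimately show ?thesis
      using card_le_max_code_size[OF \<theta>0 \<theta>(2)] by (metis card_image)
  qed
qed

section \<open>Volume comparison\<close>

text \<open>Integrate the sum of the indicators of the \<open>A i\<close>: its value at a point is
  the covering multiplicity there, at most \<open>k\<close> on \<open>B\<close> and zero
  outside.\<close>

lemma sum_measure_le_multiplicity:
  assumes F: "finite F" and A: "\<And>i. i \<in> F \<Longrightarrow> A i \<in> fmeasurable M" and B: "B \<in> fmeasurable M"
    and sub: "\<And>i. i \<in> F \<Longrightarrow> A i \<subseteq> B" and k: "\<And>x. x \<in> B \<Longrightarrow> card {i \<in> F. x \<in> A i} \<le> k"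
  shows "(\<Sum>i\<in>F. measure M (A i)) \<le> real k * measure M B"
proof -
  have int: "integrable M (indicat_real S)" if "S \<in> fmeasurable M" for S
    using that by (auto simp: fmeasurable_def)
  have "(\<Sum>i\<in>F. measure M (A i)) = (\<Sum>i\<in>F. \<integral>x. indicat_real (A i) x \<partial>M)"
    using A by (intro sum.cong) (auto simp: fmeasurable_def Int_absorb2 sets.sets_into_space)
  also have "\<dots> = (\<integral>x. (\<Sum>i\<in>F. indicat_real (A i) x) \<partial>M)"
    using A int by (intro Bochner_Integration.integral_sum[symmetric]) blast
  also have "\<dots> \<le> (\<integral>x. real k * indicat_real B x \<partial>M)"
  proof (rule integral_mono)
    show "integrable M (\<lambda>x. \<Sum>i\<in>F. indicat_real (A i) x)"
      using A int by (intro Bochner_Integration.integrable_sum) blast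
    show "integrable M (\<lambda>x. real k * indicat_real B x)"
      using B int by (intro integrable_mult_right) blast
    fix x
    have "(\<Sum>i\<in>F. indicat_real (A i) x) = real (card {i \<in> F. x \<in> A i})"
      using F by (simp add: indicator_def sum.If_cases Int_def)
    also have "\<dots> \<le> real k * indicat_real B x"
    proof (cases "x \<in> B")
      case True
      then show ?thesis
        using k by simp
    next
      case False
      then have empty: "{i \<in> F. x \<in> A i} = {}"
        using sub by blast
      show ?thesis
        unfolding empty by simp
    qed
    finally show "(\<Sum>i\<in>F. indicat_real (A i) x) \<le> real k * indicat_real B x" .
  qed
  also have "\<dots> = real k * measure M B"
    using B by (auto simp: fmeasurable_def Int_absorb2 sets.sets_into_space)
  finally show ?thesis .
qed

lemma disjnt_ball_imp_dist_ge:
  fixes x y :: "'a::euclidean_space"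
  assumes "disjnt (ball x r) (ball y r)"
  shows "2 * r \<le> dist x y"
proof (rule ccontr)
  assume "\<not> 2 * r \<le> dist x y"
  then have "midpoint x y \<in> ball x r \<inter> ball y r"
    by (simp add: dist_midpoint)
  then show False
    using assms by (auto simp: disjnt_def)
qed

lemma upper_density_le:
  fixes P :: "'a::euclidean_space set set"
  assumes \<theta>: "pi / 3 \<le> \<theta>" "\<theta> \<le> pi" and P: "ball_packing P"
  shows "upper_density P \<le> ereal (sin (\<theta> / 2) ^ DIM('a) * real (max_code_size TYPE('a) \<theta>))"
proof -
  define s where "s = sin (\<theta> / 2)"
  define k where "k = max_code_size TYPE('a) \<theta>"
  define n where "n = DIM('a)"
  define V where "V = unit_ball_vol (real n)"
  have "0 < \<theta>"
    using \<theta> pi_gt_zero by linarith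
  then have s: "0 < s"
    unfolding s_def using \<theta> by (intro sin_gt_zero) auto
  have V: "0 < V"
    by (simp add: V_def)
  obtain r where r: "0 < r" and cball: "\<And>B. B \<in> P \<Longrightarrow> \<exists>c. B = cball c r"
    and disj: "pairwise (\<lambda>B B'. disjnt (interior B) (interior B')) P"
    using P unfolding ball_packing_def by blast
  define R where "R = r / s"
  have R: "0 < R"
    using r s by (simp add: R_def)
  define X where "X = {c. cball c r \<in> P}"
  have sep: "2 * r \<le> dist x y" if "x \<in> X" "y \<in> X" "x \<noteq> y" for x y
  proof -
    \<comment> \<open>Since \<open>r\<close> is positive, a ball determines its center, so pairwise
      disjointness in \<open>P\<close> applies to distinct centers.\<close>
    have "cball x r \<noteq> cball y r"
      using that(3) r by (simp add: cball_eq_cball_iff)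
    then have "disjnt (ball x r) (ball y r)"
      using pairwiseD[OF disj, of "cball x r" "cball y r"] that by (simp add: X_def)
    then show ?thesis
      by (rule disjnt_ball_imp_dist_ge)
  qed
  have ball_vol: "measure lebesgue (ball c \<rho>) = V * \<rho> ^ n" if "0 \<le> \<rho>" for c :: 'a and \<rho>
    using that content_ball[of \<rho> c] by (simp add: V_def n_def measure_completion)
  have cball_vol: "measure lebesgue (cball c \<rho>) = V * \<rho> ^ n" if "0 \<le> \<rho>" for c :: 'a and \<rho>
    using that content_cball[of \<rho> c] by (simp add: V_def n_def measure_completion)
  \<comment> \<open>A packing ball meeting \<open>cball 0 T\<close> has its center within
    \<open>T + r\<close> of the origin, so its enlargement lies in the ball of radius
    \<open>T + (r + R)\<close>. The factor \<open>s ^ n\<close> comes from scaling \<open>R\<close>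
    back to \<open>r\<close>.\<close>
  have count: "real (card F) * r ^ n \<le> s ^ n * real k * (T + (r + R)) ^ n"
    if F: "finite F" "F \<subseteq> X \<inter> cball 0 (T + r)" and T: "0 \<le> T" for F T
  proof -
    have "(\<Sum>c\<in>F. measure lebesgue (ball c R)) \<le> real k * measure lebesgue (ball (0::'a) (T + (r + R)))"
    proof (rule sum_measure_le_multiplicity[OF F(1)])
      show "ball c R \<subseteq> ball 0 (T + (r + R))" if "c \<in> F" for c
      proof
        fix x assume "x \<in> ball c R"
        moreover have "norm c \<le> T + r"
          using that F(2) by auto
        ultimately show "x \<in> ball 0 (T + (r + R))"
          using norm_triangle_sub[of x c] by (simp add: dist_norm norm_minus_commute)
      qed
      show "card {c \<in> F. p \<in> ball c R} \<le> k" for p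
        unfolding k_def using F(2) sep
        by (intro card_separated_le_max_code_size[OF \<theta>, where p = p and r = r])
          (auto simp: R_def s_def dist_commute)
    qed auto
    then have "real (card F) * (V * R ^ n) \<le> real k * (V * (T + (r + R)) ^ n)"
      using R T r by (simp add: ball_vol del: measure_completion)
    then have "V * (real (card F) * R ^ n) \<le> V * (real k * (T + (r + R)) ^ n)"
      by (simp add: mult_ac)
    then have "real (card F) * R ^ n \<le> real k * (T + (r + R)) ^ n"
      using V by simp
    then have "s ^ n * (real (card F) * R ^ n) \<le> s ^ n * (real k * (T + (r + R)) ^ n)"
      using s by (intro mult_left_mono) auto
    moreover have "r ^ n = s ^ n * R ^ n"
      using s by (simp add: R_def flip: power_mult_distrib)
    ultimately show ?thesis
      by (simp add: mult_ac)
  qed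
  have bound: "measure lebesgue (\<Union>P \<inter> cball 0 T) / measure lebesgue (cball (0::'a) T)
      \<le> s ^ n * real k * ((T + (r + R)) / T) ^ n" if T: "0 < T" for T
  proof -
    define F where "F = X \<inter> cball 0 (T + r)"
    \<comment> \<open>Finiteness of \<open>F\<close> is not known beforehand: \<open>count\<close>
      bounds all finite subsets uniformly, which forces it.\<close>
    have "finite F \<and> card F \<le> nat \<lfloor>s ^ n * real k * (T + (r + R)) ^ n / r ^ n\<rfloor>"
    proof (rule finite_if_finite_subsets_card_bdd)
      show "card G \<le> nat \<lfloor>s ^ n * real k * (T + (r + R)) ^ n / r ^ n\<rfloor>"
        if "G \<subseteq> F" "finite G" for G
        using count[of G T] that T r by (auto simp: F_def le_nat_floor field_simps)
    qed
    then have F: "finite F"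
      by blast
    have "\<Union>P \<inter> cball 0 T \<subseteq> (\<Union>c\<in>F. cball c r)"
    proof
      fix x assume x: "x \<in> \<Union>P \<inter> cball 0 T"
      then obtain c where c: "cball c r \<in> P" "x \<in> cball c r"
        using cball by blast
      then have "norm c \<le> T + r"
        using x norm_triangle_sub[of c x] by (simp add: dist_norm)
      then show "x \<in> (\<Union>c\<in>F. cball c r)"
        using c by (auto simp: F_def X_def)
    qed
    moreover have "\<Union>P = (\<Union>c\<in>X. cball c r)"
      using cball by (auto simp: X_def)
    \<comment> \<open>As a finite union of balls cut by a ball, the truncated packing is measurable,
      as monotonicity of the measure requires.\<close>
    ultimately have "\<Union>P \<inter> cball 0 T = (\<Union>c\<in>F. cball c r) \<inter> cball 0 T"
      by (auto simp: F_def)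
    then have "measure lebesgue (\<Union>P \<inter> cball 0 T) \<le> measure lebesgue (\<Union>c\<in>F. cball c r)"
      using F by (auto intro!: measure_mono_fmeasurable fmeasurable.finite_UN sets.Int sets.finite_UN)
    also have "\<dots> \<le> (\<Sum>c\<in>F. measure lebesgue (cball c r))"
      using F by (intro measure_UNION_le) auto
    also have "\<dots> = V * (real (card F) * r ^ n)"
      using r by (simp add: cball_vol del: measure_completion)
    also have "\<dots> \<le> V * (s ^ n * real k * (T + (r + R)) ^ n)"
      using V T F by (intro mult_left_mono count) (auto simp: F_def)
    finally have "measure lebesgue (\<Union>P \<inter> cball 0 T) / measure lebesgue (cball (0::'a) T)
        \<le> V * (s ^ n * real k * (T + (r + R)) ^ n) / (V * T ^ n)"
      unfolding cball_vol[OF less_imp_le[OF T]] using V T by (intro divide_right_mono) auto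
    also have "\<dots> = s ^ n * real k * ((T + (r + R)) / T) ^ n"
      using V by (simp add: power_divide)
    finally show ?thesis .
  qed
  \<comment> \<open>The extra margin \<open>r + R\<close> does not depend on \<open>T\<close>, so it
    disappears in the limit.\<close>
  have "((\<lambda>T. (T + (r + R)) / T) \<longlongrightarrow> 1 + 0) at_top"
  proof (rule Lim_transform_eventually)
    show "((\<lambda>T. 1 + (r + R) / T) \<longlongrightarrow> 1 + 0) at_top"
      by (intro tendsto_add tendsto_const tendsto_divide_0[OF tendsto_const]
        filterlim_at_top_imp_at_infinity filterlim_ident)
    show "\<forall>\<^sub>F T in at_top. 1 + (r + R) / T = (T + (r + R)) / T"
      using eventually_gt_at_top[of 0] by eventually_elim (simp add: add_divide_distrib)
  qed
  then have "((\<lambda>T. s ^ n * real k * ((T + (r + R)) / T) ^ n) \<longlongrightarrow> s ^ n * real k * (1 + 0) ^ n) at_top"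
    by (intro tendsto_intros)
  then have lim: "((\<lambda>T. ereal (s ^ n * real k * ((T + (r + R)) / T) ^ n)) \<longlongrightarrow> ereal (s ^ n * real k)) at_top"
    by simp
  have "\<forall>\<^sub>F T in at_top. ereal (measure lebesgue (\<Union>P \<inter> cball 0 T) / measure lebesgue (cball (0::'a) T))
      \<le> ereal (s ^ n * real k * ((T + (r + R)) / T) ^ n)"
    using eventually_gt_at_top[of 0] unfolding ereal_less_eq by eventually_elim (rule bound)
  then have "upper_density P \<le> Limsup at_top (\<lambda>T. ereal (s ^ n * real k * ((T + (r + R)) / T) ^ n))"
    unfolding upper_density_def by (rule Limsup_mono)
  also have "\<dots> = ereal (s ^ n * real k)"
    using lim by (intro lim_imp_Limsup) auto
  finally show ?thesis
    by (simp add: s_def k_def n_def)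
qed

theorem proposition2p1:
  fixes \<theta> :: real
  assumes "pi / 3 \<le> \<theta>" and "\<theta> \<le> pi"
  shows "packing_density TYPE(real ^ 'n)
    \<le> ereal (sin (\<theta> / 2) ^ CARD('n) * real (max_code_size TYPE(real ^ 'n) \<theta>))"
  unfolding packing_density_def
  using upper_density_le[OF assms, where 'a = "real ^ 'n"] by (intro SUP_least) simp

end
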